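(* Let $0<p\le\infty$ and $0<\alpha<\infty$. No non-trivial semigroup of analytic functions induces a strongly continuous semigroup of composition operators on $H(p,\infty,\alpha)$. In other words, $[\varphi_t,H(p,\infty,\alpha)]\subsetneq H(p,\infty,\alpha)$ for every non-trivial semigroup of analytic functions $(\varphi_t)$.
   Context: A semigroup of analytic functions is a family $\{\varphi_t:t\ge0\}$ of analytic self-maps of the unit disk $\mathbb{D}$ with $\varphi_0=\mathrm{id}$, $\varphi_{t+s}=\varphi_t\circ\varphi_s$, and $\varphi_t\to\varphi_0$ uniformly on compact subsets as $t\to0^+$; it is trivial if all $\varphi_t$ are the identity. $M_p(r,f)=\left(\int_0^{2\pi}|f(re^{i\theta})|^p\frac{d\theta}{2\pi}\right)^{1/p}$ ($p<\infty$), $M_\infty(r,f)=\max_\theta|f(re^{i\theta})|$; $H(p,\infty,\alpha)$ is the space of analytic $f$ on $\mathbb{D}$ with $\|f\|_{p,\infty,\alpha}=\sup_{0\le r<1}(1-r)^\alpha M_p(r,f)<\infty$. For a space $X$, $[\varphi_t,X]=\{f\in X:\|f\circ\varphi_t-f\|_X\to0\text{ as }t\to0^+\}$. *)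

theory Defs
  imports "HOL-Analysis.Analysis" "HOL-Library.Extended_Real"
begin

abbreviation unit_disc :: "complex set" where
  "unit_disc \<equiv> ball 0 1"

definition analytic_semigroup :: "(real \<Rightarrow> complex \<Rightarrow> complex) \<Rightarrow> bool" where
  "analytic_semigroup \<phi> \<longleftrightarrow>
     (\<forall>t\<ge>0. \<phi> t holomorphic_on unit_disc \<and> \<phi> t ` unit_disc \<subseteq> unit_disc) \<and>
     (\<forall>z\<in>unit_disc. \<phi> 0 z = z) \<and>
     (\<forall>t\<ge>0. \<forall>s\<ge>0. \<forall>z\<in>unit_disc. \<phi> (t + s) z = \<phi> t (\<phi> s z)) \<and>
     (\<forall>K. compact K \<and> K \<subseteq> unit_disc \<longrightarrow> uniform_limit K \<phi> (\<phi> 0) (at_right 0))"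

definition trivial_semigroup :: "(real \<Rightarrow> complex \<Rightarrow> complex) \<Rightarrow> bool" where
  "trivial_semigroup \<phi> \<longleftrightarrow> (\<forall>t\<ge>0. \<forall>z\<in>unit_disc. \<phi> t z = z)"

definition Mp :: "ereal \<Rightarrow> real \<Rightarrow> (complex \<Rightarrow> complex) \<Rightarrow> real" where
  "Mp p r f =
     (if p = \<infinity> then (SUP \<theta>\<in>{0..2*pi}. norm (f (of_real r * cis \<theta>)))
      else (integral {0..2*pi} (\<lambda>\<theta>. norm (f (of_real r * cis \<theta>)) powr real_of_ereal p) / (2*pi))
             powr (1 / real_of_ereal p))"

definition Hnorm :: "ereal \<Rightarrow> real \<Rightarrow> (complex \<Rightarrow> complex) \<Rightarrow> ereal" where
  "Hnorm p \<alpha> f = (SUP r\<in>{0..<1}. ereal ((1 - r) powr \<alpha> * Mp p r f))"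

definition Hspace :: "ereal \<Rightarrow> real \<Rightarrow> (complex \<Rightarrow> complex) set" where
  "Hspace p \<alpha> = {f. f holomorphic_on unit_disc \<and> Hnorm p \<alpha> f < \<infinity>}"

definition strong_cont_space ::
  "(real \<Rightarrow> complex \<Rightarrow> complex) \<Rightarrow> ereal \<Rightarrow> real \<Rightarrow> (complex \<Rightarrow> complex) set" where
  "strong_cont_space \<phi> p \<alpha> =
     {f \<in> Hspace p \<alpha>. ((\<lambda>t. Hnorm p \<alpha> (\<lambda>z. f (\<phi> t z) - f z)) \<longlongrightarrow> 0) (at_right 0)}"

end

theory Submission
  imports Defs "HOL-Complex_Analysis.Complex_Analysis"
begin

text \<open>
  Test on the monomials \<open>N\<^sup>\<alpha> z\<^sup>N\<close>, whose norms are bounded in \<open>N\<close>. If a self-map \<open>\<phi>\<close> of the disc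
  satisfied \<open>\<phi>\<^sup>N \<approx> z\<^sup>N\<close> in the mean on \<open>|z| = 1 - 1/n\<close> for all \<open>n \<le> N < 2n\<close>, then the
  factorization of \<open>\<phi>\<^sup>n (\<phi>\<^sup>n - z\<^sup>n)\<close> by \<open>\<phi> - z\<close> would force \<open>|\<phi> - z| \<le> C/n\<close> on a fixed proportion
  of that circle; by the subharmonicity of \<open>log |\<phi> - z|\<close> this is impossible for large \<open>n\<close> unless \<open>\<phi>\<close>
  is the identity. So, with a constant not depending on \<open>\<phi>\<close>, \<open>\<phi> \<noteq> id\<close> moves some monomial of
  arbitrarily large degree by a fixed amount. Applying this to \<open>\<phi>\<^sub>t\<close> for a sequence of times \<open>t \<longrightarrow> 0\<close>
  with \<open>\<phi>\<^sub>t \<noteq> id\<close>, and adding up monomials of rapidly increasing degrees, gives a function \<open>f\<close> of the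
  space with \<open>\<parallel>f \<circ> \<phi>\<^sub>t - f\<parallel>\<close> bounded below along that sequence.
\<close>

subsection \<open>Means over circles and grids\<close>

text \<open>Zeros of \<open>g\<close> are isolated, so a small circle about 0 avoids them and
  compactness gives a positive minimum. A circle replaces the centre because \<open>g 0 = 0\<close>
  is possible.\<close>

lemma holomorphic_lower_bound_on_circle:
  assumes g: "g holomorphic_on unit_disc" and w: "w \<in> unit_disc" "g w \<noteq> 0"
  obtains \<rho> c where "0 < \<rho>" "\<rho> < 1" "0 < c" "\<And>z. norm z = \<rho> \<Longrightarrow> c \<le> norm (g z)"
proof -
  have cont: "continuous_on unit_disc g"
    using g by (rule holomorphic_on_imp_continuous_on)
  obtain s where s: "0 < s" "s \<le> 1" "\<And>z. z \<in> ball 0 s - {0} \<Longrightarrow> g z \<noteq> 0"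
  proof (cases "g 0 = 0")
    case True
    obtain s where "0 < s" "\<And>z. z \<in> ball 0 s - {0} \<Longrightarrow> g z \<noteq> 0"
      by (rule isolated_zeros[OF g, of 0 w]) (use w True in auto)
    then show ?thesis
      by (intro that[of "min s 1"]) auto
  next
    case False
    have "isCont g 0"
      using cont by (simp add: continuous_on_eq_continuous_at)
    then obtain s where "0 < s" "\<And>z. dist 0 z < s \<Longrightarrow> g z \<noteq> 0"
      using False continuous_at_avoid[of 0 g 0] by auto
    then show ?thesis
      by (intro that[of "min s 1"]) auto
  qed
  define \<rho> where "\<rho> = s / 2"
  have \<rho>: "0 < \<rho>" "\<rho> < 1" "\<rho> < s"
    using s by (auto simp: \<rho>_def)
  have "continuous_on (sphere 0 \<rho>) (\<lambda>z. norm (g z))"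
    using cont \<rho> by (intro continuous_intros continuous_on_subset[OF cont]) auto
  then obtain x where x: "x \<in> sphere 0 \<rho>" "\<And>y. y \<in> sphere 0 \<rho> \<Longrightarrow> norm (g x) \<le> norm (g y)"
    using continuous_attains_inf[of "sphere 0 \<rho>" "\<lambda>z. norm (g z)"] \<rho> by auto
  have "g x \<noteq> 0"
    using s(3)[of x] x(1) \<rho> by auto
  with x \<rho> show ?thesis
    by (intro that[of \<rho> "norm (g x)"]) auto
qed

lemma integral_periodic_shift:
  fixes F :: "real \<Rightarrow> real"
  assumes cont: "continuous_on UNIV F" and per: "\<And>x. F (x + T) = F x" and s: "0 \<le> s" "s \<le> T"
  shows "integral {s..s+T} F = integral {0..T} F"
proof -
  have int: "F integrable_on {a..b}" for a b
    using cont by (intro integrable_continuous_real continuous_on_subset[OF cont]) auto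
  have "integral {s..s+T} F = integral {s..T} F + integral {T..s+T} F"
    using s int by (subst Henstock_Kurzweil_Integration.integral_combine) auto
  also have "integral {T..s+T} F = integral {0..s} F"
    using integral_shift_real_ivl[of T T "s+T" F] by (simp add: per)
  also have "integral {s..T} F + integral {0..s} F = integral {0..T} F"
    using s int by (subst add.commute, subst Henstock_Kurzweil_Integration.integral_combine) auto
  finally show ?thesis .
qed

lemma sum_integral_consecutive:
  fixes F :: "real \<Rightarrow> real"
  assumes cont: "continuous_on UNIV F" and h: "0 \<le> h"
  shows "(\<Sum>j<m. integral {s + h * real j..s + h * real (Suc j)} F) = integral {s..s + h * real m} F"
proof (induction m)
  case (Suc m)
  have "F integrable_on {s..s + h * real (Suc m)}"
    by (intro integrable_continuous_real continuous_on_subset[OF cont]) auto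
  moreover have "s + h * real m \<le> s + h * real (Suc m)"
    using h by (simp add: algebra_simps)
  ultimately show ?case
    using Suc h by (simp add: Henstock_Kurzweil_Integration.integral_combine del: of_nat_Suc)
qed auto

text \<open>A Riemann sum with mesh below the modulus of uniform continuity exceeds the integral by
  an error that the strict inequality absorbs. The same \<open>m\<close> must serve every offset
  \<open>s\<close>, since the offset is only found later, by the maximum principle.\<close>

lemma grid_sum_le:
  fixes F :: "real \<Rightarrow> real" and \<eta> :: real
  assumes cont: "continuous_on UNIV F" and T: "0 < T" and per: "\<And>x. F (x + T) = F x"
    and less: "integral {0..T} F < T * \<eta>"
  obtains m :: nat where "0 < m"
    "\<And>s. 0 \<le> s \<Longrightarrow> s \<le> T \<Longrightarrow> (\<Sum>j<m. F (s + T / m * j)) \<le> m * \<eta>"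
proof -
  define e where "e = \<eta> - integral {0..T} F / T"
  have e: "e > 0"
    using less T by (simp add: e_def field_simps)
  \<comment> \<open>Grids with offset up to \<open>T\<close> reach as far as
    \<open>2*T\<close>.\<close>
  have "uniformly_continuous_on {0..2*T} F"
    by (intro compact_uniformly_continuous continuous_on_subset[OF cont]) auto
  then obtain d where d: "d > 0"
    "\<And>x y. x \<in> {0..2*T} \<Longrightarrow> y \<in> {0..2*T} \<Longrightarrow> dist x y < d \<Longrightarrow> dist (F x) (F y) < e"
    using e unfolding uniformly_continuous_on_def by metis
  obtain m :: nat where "T / d < m"
    using reals_Archimedean2 by blast
  define h where "h = T / m"
  have "0 < T / d"
    using T d by simp
  with \<open>T / d < m\<close> have "0 < real m"
    by linarith
  then have m: "0 < m" and h: "0 < h" "h < d" "h * m = T"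
    using T d \<open>T / d < m\<close> by (auto simp: h_def field_simps)
  show ?thesis
  proof (rule that[OF m])
    fix s :: real assume s: "0 \<le> s" "s \<le> T"
    have step: "h * F (s + h * j) \<le> integral {s + h * real j..s + h * real (Suc j)} F + h * e"
      if "j < m" for j
    proof -
      have le: "h * real (Suc j) \<le> T"
        unfolding h(3)[symmetric] using that h by (intro mult_left_mono) auto
      have "integral {s + h * real j..s + h * real (Suc j)} (\<lambda>_. F (s + h * j))
          \<le> integral {s + h * real j..s + h * real (Suc j)} (\<lambda>x. F x + e)"
      proof (rule integral_le)
        fix x assume x: "x \<in> {s + h * real j..s + h * real (Suc j)}"
        have "0 \<le> h * real j"
          using h by simp
        with x have "0 \<le> x"
          using s by simp
        with \<open>0 \<le> h * real j\<close> have "dist (F x) (F (s + h * j)) < e"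
          using x s le h by (intro d(2)) (auto simp: dist_real_def algebra_simps)
        then show "F (s + h * j) \<le> F x + e"
          by (simp add: dist_real_def)
      qed (auto intro!: integrable_continuous_real continuous_intros continuous_on_subset[OF cont])
      also have "\<dots> = integral {s + h * real j..s + h * real (Suc j)} F + h * e"
        using h by (subst integral_add)
          (auto intro!: integrable_continuous_real continuous_on_subset[OF cont] simp: algebra_simps)
      finally show ?thesis
        using h by (simp add: algebra_simps)
    qed
    have "h * (\<Sum>j<m. F (s + h * j))
        \<le> (\<Sum>j<m. integral {s + h * real j..s + h * real (Suc j)} F + h * e)"
      unfolding sum_distrib_left using step by (intro sum_mono) auto
    also have "\<dots> = integral {s..s + T} F + T * e"
      using sum_integral_consecutive[OF cont, of h s m] h by (simp add: sum.distrib mult_ac)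
    also have "\<dots> = T * \<eta>"
      using integral_periodic_shift[OF cont per s] T by (simp add: e_def field_simps)
    also have "\<dots> = h * (m * \<eta>)"
      using h(3) by (simp add: mult_ac)
    finally show "(\<Sum>j<m. F (s + T / m * j)) \<le> m * \<eta>"
      using h(1) unfolding h_def[symmetric] by simp
  qed
qed

text \<open>A Jensen inequality without logarithms or zero counting: the maximum principle is applied to the
  product of the rotates of \<^term>\<open>g\<close> by all \<^term>\<open>m\<close>-th roots of unity.\<close>

lemma maximum_modulus_roots_of_unity:
  assumes g: "g holomorphic_on unit_disc" and \<rho>: "0 < \<rho>" "\<rho> \<le> r" "r < 1"
    and c: "0 \<le> c" "\<And>z. norm z = \<rho> \<Longrightarrow> c \<le> norm (g z)"
  obtains s where "0 \<le> s" "s \<le> 2 * pi"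
    "c ^ m \<le> (\<Prod>j<m. norm (g (of_real r * cis (s + 2 * pi / real m * real j))))"
proof -
  define P where "P z = (\<Prod>j<m. g (cis (2 * pi / real m * real j) * z))" for z
  have holP: "P holomorphic_on unit_disc"
    unfolding P_def
    by (intro holomorphic_intros holomorphic_on_compose_gen[OF _ g, unfolded o_def])
      (auto simp: norm_mult)
  then have contP: "continuous_on unit_disc P"
    by (rule holomorphic_on_imp_continuous_on)
  have "continuous_on (sphere 0 r) (\<lambda>z. norm (P z))"
    using \<rho> by (intro continuous_intros continuous_on_subset[OF contP]) auto
  moreover have "of_real r \<in> sphere (0::complex) r"
    using \<rho> by simp
  ultimately obtain w where w: "w \<in> sphere 0 r" "\<And>z. z \<in> sphere 0 r \<Longrightarrow> norm (P z) \<le> norm (P w)"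
    using continuous_attains_sup[of "sphere 0 r" "\<lambda>z. norm (P z)"] by (metis compact_sphere empty_iff)
  have "norm (P (of_real \<rho>)) \<le> norm (P w)"
  proof (rule maximum_modulus_frontier[of P "cball 0 r"])
    show "P holomorphic_on interior (cball 0 r)"
      using \<rho> by (intro holomorphic_on_subset[OF holP]) auto
    show "continuous_on (closure (cball 0 r)) P"
      using \<rho> by (intro continuous_on_subset[OF contP]) auto
    show "norm (P z) \<le> norm (P w)" if "z \<in> frontier (cball 0 r)" for z
      using w that \<rho> by (auto simp: frontier_cball)
  qed (use \<rho> in auto)
  moreover have "c ^ m \<le> norm (P (of_real \<rho>))"
  proof -
    have "(\<Prod>j<m. c) \<le> (\<Prod>j<m. norm (g (cis (2 * pi / real m * real j) * of_real \<rho>)))"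
      using c \<rho> by (intro prod_mono) (auto simp: norm_mult)
    then show ?thesis
      by (simp add: P_def prod_norm)
  qed
  \<comment> \<open>The argument of the maximum point \<open>w\<close> is the offset
    \<open>s\<close>; the rotates of \<open>w\<close> are then the grid points.\<close>
  moreover have "w = of_real r * cis (Arg2pi w)"
    using Arg2pi_eq[of w] w(1) by (simp add: cis_conv_exp)
  then have "norm (P w) = (\<Prod>j<m. norm (g (of_real r * cis (Arg2pi w + 2 * pi / real m * real j))))"
    unfolding P_def prod_norm[symmetric]
    by (intro prod.cong refl arg_cong[where f = "\<lambda>z. norm (g z)"])
       (metis cis_mult mult.commute mult.left_commute)
  ultimately show ?thesis
    using Arg2pi_ge_0[of w] Arg2pi_lt_2pi[of w] by (intro that[of "Arg2pi w"]) auto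
qed

text \<open>The factor \<^term>\<open>a ^ n\<close> multiplying the divided difference of the powers keeps all the
  exponents in \<open>{n..<2*n}\<close>, where the test functions are seen at radius \<open>1 - 1/n\<close>.\<close>

lemma norm_diff_mult_power_sum_le:
  fixes a z :: complex
  assumes "norm a \<le> 1" "norm z \<le> 1"
  shows "norm (a - z) * (real n * norm z ^ (2 * n - 1) - (\<Sum>k<n. norm (a ^ (n + k) - z ^ (n + k)))) \<le> 2"
proof -
  \<comment> \<open>\<open>K\<close> is \<open>a ^ n\<close> times the divided difference of the
    \<open>n\<close>-th powers at \<open>a\<close> and \<open>z\<close>.\<close>
  define K where "K = (\<Sum>k<n. a ^ (n + k) * z ^ (n - Suc k))"
  have "K = a ^ n * (\<Sum>k<n. z ^ (n - Suc k) * a ^ k)"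
    by (simp add: K_def sum_distrib_left power_add mult_ac)
  then have "(a - z) * K = a ^ n * (a ^ n - z ^ n)"
    by (simp add: power_diff_sumr2)
  then have "norm (a - z) * norm K = norm a ^ n * norm (a ^ n - z ^ n)"
    by (metis norm_mult norm_power)
  also have "\<dots> \<le> 1 * (1 + 1)"
    using assms
    by (intro mult_mono power_le_one order_trans[OF norm_triangle_ineq4] add_mono)
       (auto simp: norm_power power_le_one)
  finally have K: "norm (a - z) * norm K \<le> 2"
    by simp
  \<comment> \<open>Replacing \<open>a\<close> by \<open>z\<close> in any summand of
    \<open>K\<close> gives \<open>z ^ (2 * n - 1)\<close>, so \<open>K\<close> is close to
    \<open>n\<close> copies of that power when the powers of \<open>a\<close> and \<open>z\<close>
    are close.\<close>
  have "of_nat n * z ^ (2 * n - 1) - K = (\<Sum>k<n. (z ^ (n + k) - a ^ (n + k)) * z ^ (n - Suc k))"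
  proof -
    have "of_nat n * z ^ (2 * n - 1) = (\<Sum>k<n. z ^ (n + k) * z ^ (n - Suc k))"
      by (simp add: power_add[symmetric] mult_2)
    then show ?thesis
      by (simp add: K_def sum_subtractf left_diff_distrib)
  qed
  also have "norm \<dots> \<le> (\<Sum>k<n. norm (a ^ (n + k) - z ^ (n + k)))"
  proof (rule sum_norm_le)
    fix k
    have "norm ((z ^ (n + k) - a ^ (n + k)) * z ^ (n - Suc k))
        \<le> norm (z ^ (n + k) - a ^ (n + k)) * 1"
      unfolding norm_mult
      using assms by (intro mult_left_mono) (auto simp: norm_power power_le_one)
    then show "norm ((z ^ (n + k) - a ^ (n + k)) * z ^ (n - Suc k)) \<le> norm (a ^ (n + k) - z ^ (n + k))"
      by (simp add: norm_minus_commute)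
  qed
  finally have "norm (of_nat n * z ^ (2 * n - 1) - K) \<le> (\<Sum>k<n. norm (a ^ (n + k) - z ^ (n + k)))" .
  moreover have "real n * norm z ^ (2 * n - 1) - norm K \<le> norm (of_nat n * z ^ (2 * n - 1) - K)"
    using norm_triangle_ineq2[of "of_nat n * z ^ (2 * n - 1)" K] by (simp add: norm_mult norm_power)
  ultimately have "real n * norm z ^ (2 * n - 1) - (\<Sum>k<n. norm (a ^ (n + k) - z ^ (n + k))) \<le> norm K"
    by linarith
  then show ?thesis
    using K mult_left_mono[of _ "norm K" "norm (a - z)"] by (meson norm_ge_zero order_trans)
qed

section \<open>Displacement of monomials by a self-map\<close>

text \<open>For x \<le> 1/2 one has 1 - x \<ge> exp(-2x); take x = 1/n and raise to the power 2n.
  The bound does not depend on \<open>n\<close>.\<close>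

lemma one_minus_inverse_power_ge:
  assumes "2 \<le> n"
  shows "exp (- 4) \<le> (1 - 1 / real n) ^ (2 * n - 1)"
proof -
  define x where "x = 1 / real n"
  have x: "0 < x" "x \<le> 1 / 2"
    using assms by (auto simp: x_def field_simps)
  have "x * x \<le> (1 / 2) * x"
    using x by (intro mult_right_mono) auto
  then have "- (2 * x) \<le> ln (1 - x)"
    using ln_one_minus_pos_lower_bound[of x] x unfolding power2_eq_square by linarith
  then have "exp (- (2 * x)) \<le> 1 - x"
    using x by (subst (asm) ln_ge_iff) auto
  then have "exp (- (2 * x)) ^ (2 * n) \<le> (1 - x) ^ (2 * n)"
    by (intro power_mono) auto
  also have "\<dots> \<le> (1 - x) ^ (2 * n - 1)"
    using x by (intro power_decreasing) auto
  also have "exp (- (2 * x)) ^ (2 * n) = exp (- 4)"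
    using assms by (simp add: exp_of_nat_mult[symmetric] x_def)
  finally show ?thesis
    by (simp add: x_def)
qed

lemma continuous_on_circle:
  assumes "continuous_on unit_disc f" "0 \<le> r" "r < 1"
  shows "continuous_on S (\<lambda>\<theta>. f (of_real r * cis \<theta>))"
  using assms by (intro continuous_on_compose2[OF assms(1)] continuous_intros) (auto simp: norm_mult)

text \<open>Only the threshold \<open>M\<close> depends on \<open>\<phi>\<close>; the constant does
  not. If all the means were small, \<open>\<phi> z - z\<close> would be of order 1/n on much of the
  circle, which the maximum principle for its rotates excludes once \<open>n\<close> is
  large.\<close>

lemma mean_power_difference_ge:
  assumes hol: "\<phi> holomorphic_on unit_disc" and into: "\<phi> ` unit_disc \<subseteq> unit_disc"
    and ne: "w \<in> unit_disc" "\<phi> w \<noteq> w"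
  obtains M where "\<And>n. M \<le> n \<Longrightarrow> \<exists>N\<in>{n..<2*n}.
    2 * pi * (exp (- 4) / 4) \<le> integral {0..2*pi} (\<lambda>\<theta>.
      norm (\<phi> (of_real (1 - 1 / real n) * cis \<theta>) ^ N - (of_real (1 - 1 / real n) * cis \<theta>) ^ N))"
proof -
  define g where "g z = \<phi> z - z" for z
  define \<kappa> :: real where "\<kappa> = exp (- 4)"
  have \<kappa>: "0 < \<kappa>"
    by (simp add: \<kappa>_def)
  have holg: "g holomorphic_on unit_disc"
    unfolding g_def by (intro holomorphic_intros hol)
  obtain \<rho> c where \<rho>: "0 < \<rho>" "\<rho> < 1" and c: "0 < c" "\<And>z. norm z = \<rho> \<Longrightarrow> c \<le> norm (g z)"
    using holomorphic_lower_bound_on_circle[OF holg ne(1)] ne(2) unfolding g_def by auto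
  \<comment> \<open>The four bounds serve, in order, the power estimate,
    \<open>\<rho> \<le> r\<close>, \<open>y \<le> 1\<close>, and the final contradiction with
    \<open>c\<^sup>2 \<le> 4 * y\<close>.\<close>
  obtain M :: nat where M: "max (max 2 (1 / (1 - \<rho>))) (max (2 / \<kappa>) (8 / (\<kappa> * c\<^sup>2))) < M"
    using reals_Archimedean2 by blast
  show ?thesis
  proof (rule that[of M], rule ccontr)
    fix n assume "M \<le> n" and "\<not> (\<exists>N\<in>{n..<2*n}.
      2 * pi * (exp (- 4) / 4) \<le> integral {0..2*pi} (\<lambda>\<theta>.
      norm (\<phi> (of_real (1 - 1 / real n) * cis \<theta>) ^ N - (of_real (1 - 1 / real n) * cis \<theta>) ^ N)))"
    note small = this(2)
    have n: "2 < n" "1 / (1 - \<rho>) < n" "2 / \<kappa> < n" "8 / (\<kappa> * c\<^sup>2) < n"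
      using M \<open>M \<le> n\<close> by auto
    define r where "r = 1 - 1 / real n"
    have r: "0 < r" "r < 1" "\<rho> \<le> r"
      using n \<rho> by (auto simp: r_def field_simps)
    have r_power: "\<kappa> \<le> r ^ (2 * n - 1)"
      using one_minus_inverse_power_ge[of n] n by (simp add: \<kappa>_def r_def)
    define z where "z \<theta> = of_real r * cis \<theta>" for \<theta>
    have norm_z: "norm (z \<theta>) = r" for \<theta>
      using r by (simp add: z_def norm_mult)
    have norm_\<phi>: "norm (\<phi> (z \<theta>)) \<le> 1" for \<theta>
      using into norm_z[of \<theta>] r by (force simp: image_subset_iff)
    \<comment> \<open>Averaging over all exponents in \<open>{n..<2*n}\<close> gives the sum
      occurring in \<open>norm_diff_mult_power_sum_le\<close>.\<close>
    define A where "A \<theta> = (\<Sum>k<n. norm (\<phi> (z \<theta>) ^ (n + k) - z \<theta> ^ (n + k))) / n" for \<theta>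
    have cont: "continuous_on UNIV (\<lambda>\<theta>. norm (\<phi> (z \<theta>) ^ k - z \<theta> ^ k))" for k
      using continuous_on_circle[OF holomorphic_on_imp_continuous_on[OF hol], of r] r
      unfolding z_def by (intro continuous_intros) auto
    have "integral {0..2*pi} A = (\<Sum>k<n. integral {0..2*pi} (\<lambda>\<theta>. norm (\<phi> (z \<theta>) ^ (n + k) - z \<theta> ^ (n + k)))) / n"
      unfolding A_def
      by (simp add: integral_sum integrable_continuous_real continuous_on_subset[OF cont])
    also have "\<dots> < (\<Sum>k<n. 2 * pi * (\<kappa> / 4)) / n"
      using n small by (intro divide_strict_right_mono sum_strict_mono)
        (auto simp: z_def r_def \<kappa>_def not_le lessThan_empty_iff)
    finally have "integral {0..2*pi} A < 2 * pi * (\<kappa> / 4)"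
      using n by simp
    moreover have "continuous_on UNIV A"
      unfolding A_def using n by (intro continuous_intros cont) auto
    moreover have "A (\<theta> + 2 * pi) = A \<theta>" for \<theta>
      by (simp add: A_def z_def cis_mult[symmetric])
    ultimately obtain m :: nat where m: "0 < m"
      "\<And>s. 0 \<le> s \<Longrightarrow> s \<le> 2 * pi \<Longrightarrow> (\<Sum>j<m. A (s + 2 * pi / m * j)) \<le> m * (\<kappa> / 4)"
      using grid_sum_le[of A "2 * pi" "\<kappa> / 4"] by auto
    \<comment> \<open>\<open>2 * y\<close> is the bound for \<open>norm (g (z \<theta>))\<close> at
      points where \<open>A \<theta> \<le> \<kappa> / 2\<close>.\<close>
    define y where "y = 2 / (\<kappa> * n)"
    have y: "0 < y" "y \<le> 1"
      using n \<kappa> by (auto simp: y_def field_simps)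
    \<comment> \<open>In this form the product over a grid depends only on the sum of \<^term>\<open>A\<close>.\<close>
    have g_le: "norm (g (z \<theta>)) \<le> 2 * y powr (1 - 2 / \<kappa> * A \<theta>)" for \<theta>
    \<comment> \<open>Either \<open>A\<close> is small and the factorization bounds
      \<open>g\<close>, or the exponent of \<open>y \<le> 1\<close> is negative and the trivial
      bound 2 suffices.\<close>
    proof (cases "A \<theta> \<le> \<kappa> / 2")
      case True
      have "norm (g (z \<theta>)) * (n * (\<kappa> / 2)) \<le> norm (g (z \<theta>)) * (n * (r ^ (2 * n - 1) - A \<theta>))"
        using True r_power by (intro mult_left_mono) auto
      also have "\<dots> \<le> 2"
        using norm_diff_mult_power_sum_le[OF norm_\<phi>, of "z \<theta>" \<theta> n] n r
        by (simp add: norm_z g_def A_def right_diff_distrib)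
      finally have "norm (g (z \<theta>)) \<le> 2 * y powr 1"
        using n \<kappa> y by (simp add: y_def field_simps)
      also have "\<dots> \<le> 2 * y powr (1 - 2 / \<kappa> * A \<theta>)"
        using y \<kappa> by (intro mult_left_mono powr_mono') (auto simp: A_def intro!: divide_nonneg_nonneg mult_nonneg_nonneg sum_nonneg)
      finally show ?thesis .
    next
      case False
      have "norm (g (z \<theta>)) \<le> 2 * y powr 0"
        using norm_triangle_ineq4[of "\<phi> (z \<theta>)" "z \<theta>"] norm_\<phi>[of \<theta>] norm_z[of \<theta>] r y
        by (simp add: g_def)
      also have "\<dots> \<le> 2 * y powr (1 - 2 / \<kappa> * A \<theta>)"
        using y \<kappa> False by (intro mult_left_mono powr_mono') (auto simp: field_simps)
      finally show ?thesis .
    qed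
    obtain s where s: "0 \<le> s" "s \<le> 2 * pi"
      "c ^ m \<le> (\<Prod>j<m. norm (g (of_real r * cis (s + 2 * pi / real m * real j))))"
      using maximum_modulus_roots_of_unity[OF holg \<rho>(1) r(3,2) less_imp_le[OF c(1)] c(2)] by metis
    have "c ^ m \<le> (\<Prod>j<m. 2 * y powr (1 - 2 / \<kappa> * A (s + 2 * pi / m * j)))"
      by (rule order_trans[OF s(3)], intro prod_mono conjI norm_ge_zero)
         (use g_le in \<open>simp add: z_def\<close>)
    also have "\<dots> = 2 ^ m * y powr (m - 2 / \<kappa> * (\<Sum>j<m. A (s + 2 * pi / m * j)))"
      using y by (simp add: prod.distrib powr_sum[symmetric] sum_subtractf sum_distrib_left)
    \<comment> \<open>The grid mean of \<open>A\<close> is at most \<open>\<kappa> / 4\<close>, so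
      at least half of the exponent \<open>m\<close> survives.\<close>
    also have "\<dots> \<le> 2 ^ m * y powr (m * (1 / 2))"
      using m(2)[OF s(1,2)] y \<kappa> by (intro mult_left_mono powr_mono') (auto simp: field_simps)
    also have "y powr (m * (1 / 2)) = sqrt y ^ m"
      using y by (simp add: powr_half_sqrt[symmetric] powr_realpow[symmetric] powr_powr mult.commute)
    finally have "c ^ m \<le> (2 * sqrt y) ^ m"
      by (simp add: power_mult_distrib)
    then have "c \<le> 2 * sqrt y"
      using m(1) y by (subst (asm) power_mono_iff) (use c in auto)
    then have "c\<^sup>2 \<le> (2 * sqrt y)\<^sup>2"
      using c by (intro power_mono) auto
    then have "c\<^sup>2 \<le> 4 * y"
      using y by (simp add: power_mult_distrib)
    then show False
      using n(4) c(1) \<kappa> n(1) by (simp add: y_def field_simps)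
  qed
qed

subsection \<open>Integral means\<close>

lemma continuous_on_norm_powr_circle:
  assumes "continuous_on unit_disc f" "0 \<le> r" "r < 1" "0 < q"
  shows "continuous_on S (\<lambda>\<theta>. norm (f (of_real r * cis \<theta>)) powr q)"
  using assms by (intro continuous_on_powr' continuous_intros continuous_on_circle) auto

lemma Mp_le:
  assumes f: "continuous_on unit_disc f" and r: "0 \<le> r" "r < 1" and p: "0 < p"
    and B: "\<And>z. norm z = r \<Longrightarrow> norm (f z) \<le> B"
  shows "Mp p r f \<le> B"
proof (cases "p = \<infinity>")
  case True
  have "(SUP \<theta>\<in>{0..2*pi}. norm (f (of_real r * cis \<theta>))) \<le> B"
    using r by (intro cSUP_least B) (auto simp: norm_mult)
  with True show ?thesis
    by (simp add: Mp_def)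
next
  case False
  with p obtain q where q: "p = ereal q" "0 < q"
    by (cases p) auto
  have "0 \<le> B"
    using B[of "of_real r"] r norm_ge_zero[of "f (of_real r)"] by (simp del: norm_ge_zero)
  have "integral {0..2*pi} (\<lambda>\<theta>. norm (f (of_real r * cis \<theta>)) powr q) \<le> integral {0..2*pi} (\<lambda>\<theta>. B powr q)"
    using r q f by (intro integral_le integrable_continuous_real continuous_on_norm_powr_circle
        powr_mono2 B) (auto simp: norm_mult)
  then have "integral {0..2*pi} (\<lambda>\<theta>. norm (f (of_real r * cis \<theta>)) powr q) / (2 * pi) \<le> B powr q"
    by (simp add: field_simps)
  then have "(integral {0..2*pi} (\<lambda>\<theta>. norm (f (of_real r * cis \<theta>)) powr q) / (2 * pi)) powr (1 / q)
      \<le> (B powr q) powr (1 / q)"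
    using q r f by (intro powr_mono2 divide_nonneg_nonneg integral_nonneg integrable_continuous_real
        continuous_on_norm_powr_circle) auto
  also have "\<dots> = B"
    using q \<open>0 \<le> B\<close> by (simp add: powr_powr)
  finally show ?thesis
    using q by (simp add: Mp_def)
qed

text \<open>For p < 1 the power mean is not bounded below by the arithmetic mean alone; the
  pointwise bound \<open>B\<close> makes up for this. The constant depends only on \<open>p\<close>,
  \<open>\<eta>\<close> and \<open>B\<close>. The factor \<open>s\<close> will be the weight
  \<open>(1 - r) powr \<alpha>\<close>.\<close>

lemma Mp_ge:
  assumes p: "0 < p" and \<eta>: "0 < \<eta>" and B: "0 < B"
  obtains c where "0 < c"
    "\<And>s r f. \<lbrakk>continuous_on unit_disc f; 0 \<le> r; r < 1; 0 < s; \<And>z. norm z = r \<Longrightarrow> s * norm (f z) \<le> B;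
       2 * pi * \<eta> \<le> integral {0..2*pi} (\<lambda>\<theta>. s * norm (f (of_real r * cis \<theta>)))\<rbrakk> \<Longrightarrow> c \<le> s * Mp p r f"
proof (cases "p = \<infinity>")
  case True
  show ?thesis
  proof (rule that[OF \<eta>])
    fix s r and f :: "complex \<Rightarrow> complex"
    assume f: "continuous_on unit_disc f" and r: "0 \<le> r" "r < 1" and s: "0 < s"
      and "2 * pi * \<eta> \<le> integral {0..2*pi} (\<lambda>\<theta>. s * norm (f (of_real r * cis \<theta>)))"
    note this(5)
    also have "\<dots> \<le> integral {0..2*pi} (\<lambda>\<theta>. s * Mp p r f)"
    proof (rule integral_le)
      fix \<theta> :: real assume \<theta>: "\<theta> \<in> {0..2*pi}"
      have "compact ((\<lambda>\<theta>. norm (f (of_real r * cis \<theta>))) ` {0..2*pi})"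
        using f r by (intro compact_continuous_image continuous_intros continuous_on_circle) auto
      then have "bdd_above ((\<lambda>\<theta>. norm (f (of_real r * cis \<theta>))) ` {0..2*pi})"
        by (intro bounded_imp_bdd_above compact_imp_bounded)
      then show "s * norm (f (of_real r * cis \<theta>)) \<le> s * Mp p r f"
        using True \<theta> s by (auto simp: Mp_def intro!: cSUP_upper2)
    qed (use f r in \<open>auto intro!: integrable_continuous_real continuous_intros continuous_on_circle\<close>)
    finally show "\<eta> \<le> s * Mp p r f"
      by simp
  qed
next
  case False
  with p obtain q where q: "p = ereal q" "0 < q"
    by (cases p) auto
  \<comment> \<open>Half of \<open>\<eta>\<close> is spent on the values below
    \<open>\<delta>\<close>; \<open>d\<close> results from solving the remaining inequality for the
    mean of the \<open>q\<close>-th powers.\<close>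
  define \<delta> where "\<delta> = \<eta> / 2"
  define d where "d = \<delta> * \<delta> powr q / B"
  have \<delta>: "0 < \<delta>" and d: "0 < d"
    using \<eta> B by (auto simp: \<delta>_def d_def)
  show ?thesis
  proof (rule that[of "d powr (1 / q)"])
    fix s r and f :: "complex \<Rightarrow> complex"
    assume f: "continuous_on unit_disc f" and r: "0 \<le> r" "r < 1" and s: "0 < s"
      and le: "\<And>z. norm z = r \<Longrightarrow> s * norm (f z) \<le> B"
      and "2 * pi * \<eta> \<le> integral {0..2*pi} (\<lambda>\<theta>. s * norm (f (of_real r * cis \<theta>)))"
    note this(6)
    define I where "I = integral {0..2*pi} (\<lambda>\<theta>. norm (f (of_real r * cis \<theta>)) powr q)"
    have intq: "(\<lambda>\<theta>. norm (f (of_real r * cis \<theta>)) powr q) integrable_on {0..2*pi}"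
      using f r q by (intro integrable_continuous_real continuous_on_norm_powr_circle)
    \<comment> \<open>Above \<open>\<delta>\<close>, the bound x \<le> B is weakened by the factor
      \<open>(x / \<delta>) powr q\<close>, which is at least 1.\<close>
    have split: "x \<le> \<delta> + B / \<delta> powr q * x powr q" if "0 \<le> x" "x \<le> B" for x
    proof (cases "x \<le> \<delta>")
      case True
      then show ?thesis
        using B by (simp add: add_increasing2)
    next
      case False
      then have "1 \<le> (x / \<delta>) powr q"
        using \<delta> q by (intro ge_one_powr_ge_zero) auto
      then have "B * 1 \<le> B * (x / \<delta>) powr q"
        using B by (intro mult_left_mono) auto
      then show ?thesis
        using that \<delta> by (simp add: powr_divide)
    qed
    have "2 * pi * \<eta> \<le> integral {0..2*pi} (\<lambda>\<theta>. s * norm (f (of_real r * cis \<theta>)))"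
      by fact
    also have "\<dots> \<le> integral {0..2*pi} (\<lambda>\<theta>. \<delta> + B / \<delta> powr q * s powr q * norm (f (of_real r * cis \<theta>)) powr q)"
    proof (rule integral_le)
      fix \<theta> :: real
      show "s * norm (f (of_real r * cis \<theta>)) \<le> \<delta> + B / \<delta> powr q * s powr q * norm (f (of_real r * cis \<theta>)) powr q"
        using split[of "s * norm (f (of_real r * cis \<theta>))"] le[of "of_real r * cis \<theta>"] s r
        by (simp add: norm_mult powr_mult mult.assoc)
      show "(\<lambda>\<theta>. s * norm (f (of_real r * cis \<theta>))) integrable_on {0..2*pi}"
        using f r by (intro integrable_continuous_real continuous_intros continuous_on_circle)
      show "(\<lambda>\<theta>. \<delta> + B / \<delta> powr q * s powr q * norm (f (of_real r * cis \<theta>)) powr q) integrable_on {0..2*pi}"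
        by (intro integrable_add integrable_on_mult_right intq) auto
    qed
    also have "\<dots> = 2 * pi * \<delta> + B / \<delta> powr q * s powr q * I"
      using integral_add[OF integrable_const_ivl[of \<delta> 0 "2 * pi"]
          integrable_on_mult_right[OF intq, of "B / \<delta> powr q * s powr q"]]
      by (simp only: integral_mult_right I_def) simp
    finally have "2 * pi * \<delta> \<le> B / \<delta> powr q * s powr q * I"
      by (simp add: \<delta>_def)
    then have "d \<le> s powr q * (I / (2 * pi))"
      using B \<delta> by (simp add: d_def field_simps)
    then have "d powr (1 / q) \<le> (s powr q * (I / (2 * pi))) powr (1 / q)"
      using d q by (intro powr_mono2) auto
    also have "\<dots> = (s powr q) powr (1 / q) * (I / (2 * pi)) powr (1 / q)"
      by (rule powr_mult)
    also have "\<dots> = s * Mp p r f"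
      using s q by (simp add: powr_powr Mp_def I_def)
    finally show "d powr (1 / q) \<le> s * Mp p r f" .
  qed (use d in auto)
qed

subsection \<open>Gap series\<close>

text \<open>With y = (1 - r)N, combine r^N \<le> exp(-y) and y/\<alpha> \<le> exp(y/\<alpha>). This
  bounds the monomials N^\<alpha> z^N uniformly in \<open>N\<close>.\<close>

lemma powr_mult_power_le:
  fixes \<alpha> r :: real
  assumes "0 < \<alpha>" "0 \<le> r" "r \<le> 1"
  shows "(1 - r) powr \<alpha> * (real N powr \<alpha> * r ^ N) \<le> \<alpha> powr \<alpha>"
proof -
  define y where "y = (1 - r) * real N"
  have y: "0 \<le> y"
    using assms by (simp add: y_def)
  have "(y / \<alpha>) powr \<alpha> \<le> exp (y / \<alpha>) powr \<alpha>"
    using y assms order_trans[OF _ exp_ge_add_one_self[of "y / \<alpha>"]] by (intro powr_mono2) auto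
  then have 1: "y powr \<alpha> \<le> \<alpha> powr \<alpha> * exp y"
    using y assms by (simp add: powr_divide powr_def[of "exp _"] field_simps)
  have "r ^ N \<le> exp (- (1 - r)) ^ N"
    using assms exp_ge_add_one_self[of "- (1 - r)"] by (intro power_mono) auto
  also have "\<dots> = exp (- y)"
    by (simp add: exp_of_nat_mult[symmetric] y_def algebra_simps)
  finally have "y powr \<alpha> * r ^ N \<le> (\<alpha> powr \<alpha> * exp y) * exp (- y)"
    using 1 assms by (intro mult_mono) auto
  then show ?thesis
    using assms by (simp add: y_def powr_mult mult.assoc exp_minus)
qed

lemma powr_mult_power_tendsto_0:
  fixes \<alpha> \<rho> :: real
  assumes "0 < \<alpha>" "0 \<le> \<rho>" "\<rho> < 1"
  shows "(\<lambda>N. real N powr \<alpha> * \<rho> ^ N) \<longlonglongrightarrow> 0"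
proof -
  \<comment> \<open>Half of the decay absorbs the factor \<open>real N powr \<alpha>\<close>; the
    other half is geometric.\<close>
  define r where "r = sqrt \<rho>"
  have r: "0 \<le> r" "r < 1" "r * r = \<rho>"
    using assms by (auto simp: r_def)
  define C where "C = \<alpha> powr \<alpha> / (1 - r) powr \<alpha>"
  have "real N powr \<alpha> * r ^ N \<le> C" for N
    using powr_mult_power_le[of \<alpha> r N] r assms by (simp add: C_def field_simps)
  then have "(real N powr \<alpha> * r ^ N) * r ^ N \<le> C * r ^ N" for N
    using r by (intro mult_right_mono) auto
  then have le: "\<forall>\<^sub>F N in sequentially. real N powr \<alpha> * \<rho> ^ N \<le> C * r ^ N"
    unfolding r(3)[symmetric] power_mult_distrib by (simp add: mult.assoc)
  have lim: "(\<lambda>N. C * r ^ N) \<longlonglongrightarrow> 0"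
    using r by (intro tendsto_mult_right_zero LIMSEQ_power_zero) auto
  show ?thesis
    by (rule tendsto_sandwich[OF _ le tendsto_const lim]) (use assms in auto)
qed

text \<open>Term \<open>k\<close> is examined on the circle of radius 1 - 1/n_k;
  \<open>\<rho> k\<close> leaves room for the images of that circle under a self-map.
  \<open>head_le\<close> makes the earlier terms small against
  \<open>real (n k) powr \<alpha>\<close>, and \<open>tail_le\<close> makes the later ones sum to at
  most \<open>c\<close>.\<close>

locale gap_series =
  fixes \<alpha> c :: real and n N :: "nat \<Rightarrow> nat" and \<rho> :: "nat \<Rightarrow> real"
  assumes \<alpha>: "0 < \<alpha>" and c: "0 < c"
    and n_ge: "k + 2 \<le> n k"
    and \<rho>_ge: "1 - 1 / real (n k) \<le> \<rho> k" and \<rho>_less: "\<rho> k < 1"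
    and head_le: "(\<Sum>i<k. real (N i) powr \<alpha>) \<le> c * real (n k) powr \<alpha>"
    and tail_le: "i < k \<Longrightarrow> real (N k) powr \<alpha> * \<rho> i ^ N k \<le> c * (1 / 2) ^ Suc k"
begin

definition gap_term :: "nat \<Rightarrow> complex \<Rightarrow> complex" where
  "gap_term k z = of_real (real (N k) powr \<alpha>) * z ^ N k"

definition gap_sum :: "complex \<Rightarrow> complex" where
  "gap_sum z = (\<Sum>k. gap_term k z)"

lemma norm_gap_term: "norm (gap_term k z) = real (N k) powr \<alpha> * norm z ^ N k"
  by (simp add: gap_term_def norm_mult norm_power)

lemma norm_gap_term_le:
  assumes "i < k" "norm z \<le> \<rho> i"
  shows "norm (gap_term k z) \<le> c * (1 / 2) ^ Suc k"
proof -
  have "real (N k) powr \<alpha> * norm z ^ N k \<le> real (N k) powr \<alpha> * \<rho> i ^ N k"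
    using assms by (intro mult_left_mono power_mono) auto
  with tail_le[OF assms(1)] show ?thesis
    by (simp add: norm_gap_term)
qed

lemma half_powers_sums: "(\<lambda>k. c * (1 / 2) ^ Suc k) sums c"
  using sums_mult[OF power_half_series, of c] by simp

lemma summable_gap_term:
  assumes "norm z \<le> \<rho> i"
  shows "summable (\<lambda>k. gap_term k z)"
  using norm_gap_term_le[OF _ assms]
  by (intro summable_comparison_test'[OF sums_summable[OF half_powers_sums], of "Suc i"]) auto

lemma gap_sum_approx:
  assumes "norm z \<le> \<rho> i"
  shows "norm (gap_sum z - (\<Sum>k\<le>i. gap_term k z)) \<le> c"
proof -
  let ?h = "\<lambda>k. c * (1 / 2) ^ Suc k"
  have "gap_sum z - (\<Sum>k\<le>i. gap_term k z) = (\<Sum>k. gap_term (k + Suc i) z)"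
    unfolding gap_sum_def
    by (subst suminf_minus_initial_segment[OF summable_gap_term[OF assms]]) (simp add: lessThan_Suc_atMost)
  also have "norm \<dots> \<le> (\<Sum>k. ?h (k + Suc i))"
    by (intro norm_suminf_le summable_ignore_initial_segment sums_summable[OF half_powers_sums]
        norm_gap_term_le[OF _ assms]) simp
  also have "\<dots> = c - (\<Sum>k<Suc i. ?h k)"
    using half_powers_sums
    by (subst suminf_minus_initial_segment) (auto simp: sums_iff simp del: power_Suc)
  also have "\<dots> \<le> c"
    using c sum_nonneg[of "{..<Suc i}" ?h] by simp
  finally show ?thesis .
qed

lemma ex_radius:
  assumes "r < 1"
  obtains k where "r \<le> 1 - 1 / real (n k)"
proof -
  obtain k :: nat where "1 / (1 - r) < k"
    using reals_Archimedean2 by blast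
  with n_ge[of k] have "1 / (1 - r) < n k"
    by linarith
  with assms n_ge[of k] show ?thesis
    by (intro that[of k]) (auto simp: field_simps)
qed

lemma gap_sum_holomorphic: "gap_sum holomorphic_on unit_disc"
proof (rule holomorphic_uniform_sequence[where f = "\<lambda>m z. \<Sum>k<m. gap_term k z"])
  fix z :: complex assume "z \<in> unit_disc"
  \<comment> \<open>The closed disc about \<open>z\<close> of radius \<open>r - norm z\<close> stays
    within modulus \<open>r\<close>, where the terms from some index on are dominated by a geometric
    series.\<close>
  define r where "r = (1 + norm z) / 2"
  have r: "norm z < r" "r < 1"
    using \<open>z \<in> unit_disc\<close> by (auto simp: r_def)
  obtain i where "r \<le> 1 - 1 / real (n i)"
    using ex_radius[OF r(2)] .
  then have i: "r \<le> \<rho> i"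
    using \<rho>_ge[of i] by simp
  have sub: "norm w \<le> r" if "w \<in> cball z (r - norm z)" for w
    using that norm_triangle_ineq2[of w z] by (auto simp: dist_norm norm_minus_commute)
  have "uniform_limit (cball z (r - norm z)) (\<lambda>m z. \<Sum>k<m. gap_term k z) (\<lambda>z. \<Sum>k. gap_term k z) sequentially"
  proof (rule Weierstrass_m_test_ev)
    show "\<forall>\<^sub>F k in sequentially. \<forall>w\<in>cball z (r - norm z). norm (gap_term k w) \<le> c * (1 / 2) ^ Suc k"
      using eventually_gt_at_top[of i]
      by eventually_elim (use norm_gap_term_le sub i in \<open>fastforce simp del: power_Suc\<close>)
  qed (rule sums_summable[OF half_powers_sums])
  then have "uniform_limit (cball z (r - norm z)) (\<lambda>m z. \<Sum>k<m. gap_term k z) gap_sum sequentially"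
    unfolding gap_sum_def[abs_def] .
  moreover have "cball z (r - norm z) \<subseteq> unit_disc"
    using sub r by fastforce
  ultimately show "\<exists>d>0. cball z d \<subseteq> unit_disc \<and>
      uniform_limit (cball z d) (\<lambda>m z. \<Sum>k<m. gap_term k z) gap_sum sequentially"
    using r by (intro exI[of _ "r - norm z"]) auto
qed (auto simp: gap_term_def intro!: holomorphic_intros)

text \<open>At any radius at most two terms are significant, each contributing at most
  \<open>\<alpha> powr \<alpha>\<close>; the earlier and the later terms contribute at most
  \<open>c\<close> each.\<close>

lemma gap_sum_growth:
  assumes z: "norm z < 1"
  shows "(1 - norm z) powr \<alpha> * norm (gap_sum z) \<le> 2 * \<alpha> powr \<alpha> + 2 * c"
proof -
  define r where "r = norm z"
  have r: "0 \<le> r" "r < 1"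
    using z by (auto simp: r_def)
  \<comment> \<open>By minimality 1 - r < 1/n_(k-1) if k > 0, so \<open>head_le\<close> at k - 1
    controls all terms before k - 1.\<close>
  define k where "k = (LEAST k. r \<le> 1 - 1 / real (n k))"
  have k: "r \<le> 1 - 1 / real (n k)"
    unfolding k_def using ex_radius[OF r(2)] by (metis (mono_tags, lifting) LeastI)
  have single: "(1 - r) powr \<alpha> * norm (gap_term i z) \<le> \<alpha> powr \<alpha>" for i
    using powr_mult_power_le[OF \<alpha>, of r "N i"] r by (simp add: norm_gap_term r_def)
  have "(1 - r) powr \<alpha> * (\<Sum>i\<le>k. norm (gap_term i z)) \<le> 2 * \<alpha> powr \<alpha> + c"
  proof (cases k)
    case 0
    then show ?thesis
      using order_trans[OF single[of 0], of "2 * \<alpha> powr \<alpha> + c"] c by simp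
  next
    case (Suc l)
    have "\<not> r \<le> 1 - 1 / real (n l)"
      using Suc not_less_Least[of l "\<lambda>k. r \<le> 1 - 1 / real (n k)"] unfolding k_def by simp
    then have "1 - r \<le> 1 / real (n l)"
      by simp
    then have "(1 - r) powr \<alpha> \<le> (1 / real (n l)) powr \<alpha>"
      using r \<alpha> by (intro powr_mono2) auto
    moreover have "(\<Sum>i<l. norm (gap_term i z)) \<le> c * real (n l) powr \<alpha>"
    proof (rule order_trans[OF _ head_le], rule sum_mono)
      fix i
      show "norm (gap_term i z) \<le> real (N i) powr \<alpha>"
        using z by (simp add: norm_gap_term mult_left_le power_le_one)
    qed
    ultimately have "(1 - r) powr \<alpha> * (\<Sum>i<l. norm (gap_term i z))
        \<le> (1 / real (n l)) powr \<alpha> * (c * real (n l) powr \<alpha>)"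
      by (intro mult_mono) (auto intro: sum_nonneg)
    also have "\<dots> = c"
      using n_ge[of l] by (simp add: powr_divide)
    finally show ?thesis
      using single[of l] single[of k] Suc
      by (simp add: lessThan_Suc_atMost[symmetric] distrib_left)
  qed
  moreover have "norm (gap_sum z) \<le> (\<Sum>i\<le>k. norm (gap_term i z)) + c"
  proof -
    have "norm (gap_sum z) \<le> norm (\<Sum>i\<le>k. gap_term i z) + norm (gap_sum z - (\<Sum>i\<le>k. gap_term i z))"
      by (metis add.commute diff_add_cancel norm_triangle_ineq)
    also have "\<dots> \<le> (\<Sum>i\<le>k. norm (gap_term i z)) + c"
      using k \<rho>_ge[of k] r by (intro add_mono norm_sum gap_sum_approx) (auto simp: r_def)
    finally show ?thesis .
  qed
  then have "(1 - r) powr \<alpha> * norm (gap_sum z)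
      \<le> (1 - r) powr \<alpha> * (\<Sum>i\<le>k. norm (gap_term i z)) + (1 - r) powr \<alpha> * c"
    unfolding distrib_left[symmetric] by (intro mult_left_mono) auto
  moreover have "(1 - r) powr \<alpha> * c \<le> 1 * c"
    using r c \<alpha> by (intro mult_right_mono powr_le1) auto
  ultimately show ?thesis
    by (simp add: r_def)
qed

text \<open>The head and the tail cost at most \<open>c * real (n k) powr \<alpha>\<close> each, at
  each of the two points.\<close>

lemma gap_sum_diff_approx:
  assumes "norm w \<le> \<rho> k" "norm z \<le> \<rho> k"
  shows "norm ((gap_sum w - gap_sum z) - (gap_term k w - gap_term k z)) \<le> 4 * c * real (n k) powr \<alpha>"
proof -
  have "norm (\<Sum>i<k. gap_term i x) \<le> c * real (n k) powr \<alpha>" if "norm x \<le> \<rho> k" for x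
  proof (rule order_trans[OF sum_norm_le head_le])
    show "norm (gap_term i x) \<le> real (N i) powr \<alpha>" for i
      using that \<rho>_less[of k] by (simp add: norm_gap_term mult_left_le power_le_one)
  qed
  note head = this[OF assms(1)] this[OF assms(2)]
  have "1 \<le> real (n k) powr \<alpha>"
    using n_ge[of k] \<alpha> by (intro ge_one_powr_ge_zero) auto
  then have "c \<le> c * real (n k) powr \<alpha>"
    using c by simp
  then have tail: "norm (gap_sum w - (\<Sum>i\<le>k. gap_term i w)) \<le> c * real (n k) powr \<alpha>"
      "norm (gap_sum z - (\<Sum>i\<le>k. gap_term i z)) \<le> c * real (n k) powr \<alpha>"
    using gap_sum_approx[OF assms(1)] gap_sum_approx[OF assms(2)] by linarith+
  have "(gap_sum w - gap_sum z) - (gap_term k w - gap_term k z)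
      = ((gap_sum w - (\<Sum>i\<le>k. gap_term i w)) + (\<Sum>i<k. gap_term i w))
        - ((gap_sum z - (\<Sum>i\<le>k. gap_term i z)) + (\<Sum>i<k. gap_term i z))"
    by (simp add: lessThan_Suc_atMost[symmetric])
  also have "norm \<dots> \<le> (c * real (n k) powr \<alpha> + c * real (n k) powr \<alpha>)
      + (c * real (n k) powr \<alpha> + c * real (n k) powr \<alpha>)"
    by (intro order_trans[OF norm_triangle_ineq4] order_trans[OF norm_triangle_ineq] add_mono head tail)
  finally show ?thesis
    by simp
qed

end

section \<open>Recursive choice of the gaps\<close>

text \<open>Once the earlier values are fixed, every condition on \<open>n k\<close> holds for all
  large \<open>m\<close>: m^\<alpha> outgrows the finite head, and j^\<alpha> R^j tends to 0 for the
  finitely many earlier radii R < 1.\<close>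

lemma ex_gap_sequence:
  fixes \<alpha> c :: real and M :: "nat \<Rightarrow> nat" and N :: "nat \<Rightarrow> nat \<Rightarrow> nat" and R :: "nat \<Rightarrow> nat \<Rightarrow> real"
  assumes \<alpha>: "0 < \<alpha>" and c: "0 < c"
    and R: "\<And>k m. m \<ge> 2 \<Longrightarrow> 1 - 1 / real m \<le> R k m \<and> R k m < 1"
    and N: "\<And>k m. M k \<le> m \<Longrightarrow> m \<le> N k m"
  obtains n where "\<And>k. M k \<le> n k" "gap_series \<alpha> c n (\<lambda>k. N k (n k)) (\<lambda>k. R k (n k))"
proof -
  define P where "P n k m \<longleftrightarrow> k + 2 \<le> m \<and> M k \<le> m
      \<and> (\<Sum>i<k. real (N i (n i)) powr \<alpha>) \<le> c * real m powr \<alpha>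
      \<and> (\<forall>i<k. real (N k m) powr \<alpha> * R i (n i) ^ N k m \<le> c * (1 / 2) ^ Suc k)" for n k m
  have "\<exists>n. \<forall>k. P n k (n k)"
  proof (rule dependent_wf_choice[OF wf_less_than])
    fix f g :: "nat \<Rightarrow> nat" and k m
    assume "\<And>i. (i, k) \<in> less_than \<Longrightarrow> f i = g i"
    then have "f i = g i" if "i < k" for i
      using that by simp
    then show "P f k m = P g k m"
      unfolding P_def by auto
  next
    fix k and f :: "nat \<Rightarrow> nat"
    assume IH: "\<And>i. (i, k) \<in> less_than \<Longrightarrow> P f i (f i)"
    let ?S = "\<Sum>i<k. real (N i (f i)) powr \<alpha>"
    \<comment> \<open>All \<open>j \<ge> m\<close> are covered because the exponent
      \<open>N k m\<close> is known only to be at least \<open>m\<close>.\<close>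
    have "\<forall>\<^sub>F m in sequentially. \<forall>i\<in>{..<k}. \<forall>j\<ge>m. real j powr \<alpha> * R i (f i) ^ j \<le> c * (1 / 2) ^ Suc k"
    proof (intro eventually_ball_finite finite_lessThan ballI)
      fix i assume "i \<in> {..<k}"
      with IH[of i] have "2 \<le> f i"
        by (simp add: P_def)
      have "0 \<le> 1 - 1 / real (f i)"
        using \<open>2 \<le> f i\<close> by simp
      then have "(\<lambda>j. real j powr \<alpha> * R i (f i) ^ j) \<longlonglongrightarrow> 0"
        using R[OF \<open>2 \<le> f i\<close>, of i] \<alpha> by (intro powr_mult_power_tendsto_0) linarith+
      moreover have "0 < c * (1 / 2) ^ Suc k"
        using c by simp
      ultimately have "\<forall>\<^sub>F j in sequentially. real j powr \<alpha> * R i (f i) ^ j < c * (1 / 2) ^ Suc k"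
        by (rule order_tendstoD(2))
      then have "\<forall>\<^sub>F j in sequentially. real j powr \<alpha> * R i (f i) ^ j \<le> c * (1 / 2) ^ Suc k"
        by eventually_elim simp
      then show "\<forall>\<^sub>F m in sequentially. \<forall>j\<ge>m. real j powr \<alpha> * R i (f i) ^ j \<le> c * (1 / 2) ^ Suc k"
        by (rule eventually_all_ge_at_top)
    qed
    moreover have "\<forall>\<^sub>F m in sequentially. ?S \<le> c * real m powr \<alpha>"
    proof -
      have "0 \<le> ?S"
        by (intro sum_nonneg) auto
      obtain m0 :: nat where "(?S / c) powr (1 / \<alpha>) \<le> real m0"
        using real_arch_simple by blast
      then have "?S / c \<le> real m powr \<alpha>" if "m \<ge> m0" for m
        using powr_mono2[of \<alpha> "(?S / c) powr (1 / \<alpha>)" "real m"] that \<alpha> c \<open>0 \<le> ?S\<close>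
        by (simp add: powr_powr)
      then have "?S \<le> c * real m powr \<alpha>" if "m \<ge> m0" for m
        using that c by (simp add: field_simps)
      then show ?thesis
        using eventually_sequentially by blast
    qed
    moreover have "\<forall>\<^sub>F m in sequentially. k + 2 \<le> m" "\<forall>\<^sub>F m in sequentially. M k \<le> m"
      by (rule eventually_ge_at_top)+
    ultimately have "\<forall>\<^sub>F m in sequentially. P f k m"
      by eventually_elim (use N in \<open>auto simp: P_def\<close>)
    then show "\<exists>m. P f k m"
      by (rule eventually_happens'[OF sequentially_bot])
  qed
  then obtain n where n: "\<And>k. P n k (n k)"
    by blast
  show ?thesis
  proof (rule that)
    show "M k \<le> n k" for k
      using n[of k] by (simp add: P_def)
    have "2 \<le> n k" for k
      using n[of k] by (simp add: P_def)
    then show "gap_series \<alpha> c n (\<lambda>k. N k (n k)) (\<lambda>k. R k (n k))"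
      using \<alpha> c R n unfolding P_def by unfold_locales (auto simp del: power_Suc)
  qed
qed

subsection \<open>Semigroups\<close>

text \<open>If \<open>z\<close> is moved at time \<open>T\<close>, it is moved at time T/m for every
  positive \<open>m\<close>, since a fixed point of one map is fixed by its iterates.\<close>

lemma nontrivial_semigroup_small_time:
  assumes semi: "analytic_semigroup \<phi>" and nontriv: "\<not> trivial_semigroup \<phi>" and \<delta>: "0 < \<delta>"
  obtains t z where "0 < t" "t < \<delta>" "z \<in> unit_disc" "\<phi> t z \<noteq> z"
proof -
  have \<phi>0: "\<phi> 0 z = z" if "z \<in> unit_disc" for z
    using semi that by (auto simp: analytic_semigroup_def)
  obtain T z where T: "0 \<le> T" "z \<in> unit_disc" "\<phi> T z \<noteq> z"
    using nontriv by (auto simp: trivial_semigroup_def)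
  then have "0 < T"
    using \<phi>0 by (cases "T = 0") auto
  obtain m :: nat where m: "T / \<delta> < m"
    using reals_Archimedean2 by blast
  define h where "h = T / m"
  have "0 < T / \<delta>"
    using \<open>0 < T\<close> \<delta> by simp
  with m have "0 < real m"
    by linarith
  then have h: "0 < h" "h < \<delta>" "real m * h = T"
    using \<open>0 < T\<close> \<delta> m by (auto simp: h_def field_simps)
  have "\<phi> h z \<noteq> z"
  proof
    assume eq: "\<phi> h z = z"
    have "\<phi> (real j * h) z = z" for j
    proof (induction j)
      case (Suc j)
      have "\<phi> (real j * h + h) z = \<phi> (real j * h) (\<phi> h z)"
        using semi h T(2) by (simp add: analytic_semigroup_def)
      then show ?case
        using Suc eq by (simp add: algebra_simps)
    qed (use \<phi>0 T(2) in simp)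
    from this[of m] T(3) h(3) show False
      by simp
  qed
  with h T(2) show ?thesis
    by (intro that[of h z])
qed

lemma self_map_bound_on_cball:
  assumes cont: "continuous_on unit_disc \<phi>" and into: "\<phi> ` unit_disc \<subseteq> unit_disc" and r: "0 \<le> r" "r < 1"
  shows "\<exists>\<rho>. r \<le> \<rho> \<and> \<rho> < 1 \<and> (\<forall>z. norm z \<le> r \<longrightarrow> norm (\<phi> z) \<le> \<rho>)"
proof -
  have "continuous_on (cball 0 r) (\<lambda>z. norm (\<phi> z))"
    using r by (intro continuous_intros continuous_on_subset[OF cont]) auto
  then obtain x where x: "x \<in> cball 0 r" "\<And>z. z \<in> cball 0 r \<Longrightarrow> norm (\<phi> z) \<le> norm (\<phi> x)"
    using continuous_attains_sup[of "cball 0 r" "\<lambda>z. norm (\<phi> z)"] r by auto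
  have "norm (\<phi> x) < 1"
    using x(1) r into by (auto simp: image_subset_iff)
  with x r show ?thesis
    by (intro exI[of _ "max r (norm (\<phi> x))"]) (auto simp: le_max_iff_disj)
qed

theorem theorem6p2:
  fixes p :: ereal and \<alpha> :: real and \<phi> :: "real \<Rightarrow> complex \<Rightarrow> complex"
  assumes "0 < p" and "0 < \<alpha>"
    and "analytic_semigroup \<phi>" and "\<not> trivial_semigroup \<phi>"
  shows "strong_cont_space \<phi> p \<alpha> \<subset> Hspace p \<alpha>"
proof -
  have hol: "\<phi> t holomorphic_on unit_disc" and into: "\<phi> t ` unit_disc \<subseteq> unit_disc" if "0 \<le> t" for t
    using assms(3) that by (auto simp: analytic_semigroup_def)
  define \<eta> :: real where "\<eta> = exp (- 4) / 4"
  \<comment> \<open>The approximation error \<open>4 * c\<close> then uses up exactly half of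
    \<open>\<eta>\<close>.\<close>
  define c where "c = \<eta> / 8"
  have \<eta>: "0 < \<eta>" and c: "0 < c"
    by (auto simp: \<eta>_def c_def)

  have "\<exists>t. 0 < t \<and> t < 1 / real (Suc k) \<and> (\<exists>z\<in>unit_disc. \<phi> t z \<noteq> z)" for k
    using nontrivial_semigroup_small_time[OF assms(3,4), of "1 / real (Suc k)"] by fastforce
  then obtain t where t: "\<And>k. 0 < t k" "\<And>k. t k < 1 / real (Suc k)"
      "\<And>k. \<exists>z\<in>unit_disc. \<phi> (t k) z \<noteq> z"
    by metis
  define good where "good k n N \<longleftrightarrow> N \<in> {n..<2*n} \<and> 2 * pi * \<eta> \<le> integral {0..2*pi} (\<lambda>\<theta>.
      norm (\<phi> (t k) (of_real (1 - 1 / real n) * cis \<theta>) ^ N - (of_real (1 - 1 / real n) * cis \<theta>) ^ N))" for k n N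
  have "\<exists>M. \<forall>n\<ge>M. \<exists>N. good k n N" for k
  proof -
    obtain w where w: "w \<in> unit_disc" "\<phi> (t k) w \<noteq> w"
      using t(3) by blast
    have "0 \<le> t k"
      using t(1)[of k] by simp
    show ?thesis
      by (rule mean_power_difference_ge[OF hol[OF \<open>0 \<le> t k\<close>] into[OF \<open>0 \<le> t k\<close>] w])
         (unfold good_def \<eta>_def, blast)
  qed
  then obtain M where M: "\<And>k n. M k \<le> n \<Longrightarrow> \<exists>N. good k n N"
    by metis
  define Nf where "Nf k n = (SOME N. good k n N)" for k n
  have Nf: "good k n (Nf k n)" if "M k \<le> n" for k n
    unfolding Nf_def using M[OF that] by (rule someI_ex)
  \<comment> \<open>This radius bounds both the points of modulus 1 - 1/n and their images under
    \<open>\<phi> (t k)\<close>, as \<open>gap_sum_diff_approx\<close> requires.\<close>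
  define R where "R k n = (SOME \<rho>. 1 - 1 / real n \<le> \<rho> \<and> \<rho> < 1 \<and>
      (\<forall>z. norm z \<le> 1 - 1 / real n \<longrightarrow> norm (\<phi> (t k) z) \<le> \<rho>))" for k n
  have R: "1 - 1 / real n \<le> R k n \<and> R k n < 1 \<and>
      (\<forall>z. norm z \<le> 1 - 1 / real n \<longrightarrow> norm (\<phi> (t k) z) \<le> R k n)" if "2 \<le> n" for k n
    unfolding R_def
    using that t(1)[of k] by (intro someI_ex[OF self_map_bound_on_cball] into
        holomorphic_on_imp_continuous_on[OF hol]) auto
  obtain n where n_ge_M: "\<And>k. M k \<le> n k"
      and gap: "gap_series \<alpha> c n (\<lambda>k. Nf k (n k)) (\<lambda>k. R k (n k))"
    using ex_gap_sequence[OF assms(2) c, of R M Nf] R Nf unfolding good_def by auto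
  interpret gap_series \<alpha> c n "\<lambda>k. Nf k (n k)" "\<lambda>k. R k (n k)"
    by (rule gap)
  define N where "N k = Nf k (n k)" for k
  have n2: "2 \<le> n k" for k
    using n_ge[of k] by simp
  have good: "good k (n k) (N k)" for k
    unfolding N_def by (rule Nf[OF n_ge_M])

  have cont_sum: "continuous_on unit_disc gap_sum"
    using gap_sum_holomorphic by (rule holomorphic_on_imp_continuous_on)
  have mem: "gap_sum \<in> Hspace p \<alpha>"
  proof -
    \<comment> \<open>The growth bound is pointwise and hence settles all \<open>p\<close> at
      once.\<close>
    have "Hnorm p \<alpha> gap_sum \<le> ereal (2 * \<alpha> powr \<alpha> + 2 * c)"
      unfolding Hnorm_def
    proof (rule SUP_least)
      fix r :: real assume r: "r \<in> {0..<1}"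
      have "Mp p r gap_sum \<le> (2 * \<alpha> powr \<alpha> + 2 * c) / (1 - r) powr \<alpha>"
        using r gap_sum_growth assms(1)
        by (intro Mp_le cont_sum) (auto simp: field_simps)
      then show "ereal ((1 - r) powr \<alpha> * Mp p r gap_sum) \<le> ereal (2 * \<alpha> powr \<alpha> + 2 * c)"
        using r by (simp add: field_simps)
    qed
    then have "Hnorm p \<alpha> gap_sum < \<infinity>"
      using le_less_trans by fastforce
    with gap_sum_holomorphic show ?thesis
      by (simp add: Hspace_def)
  qed

  \<comment> \<open>The first summand comes from \<open>N k < 2 * n k\<close> and a difference of
    two powers of modulus at most 1; the second is the error from the other terms.\<close>
  define B where "B = 2 * 2 powr \<alpha> + 4 * c"
  have "0 < B"
    using c by (simp add: B_def add_pos_pos)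
  obtain d where d: "0 < d"
    "\<And>s r f. \<lbrakk>continuous_on unit_disc f; 0 \<le> r; r < 1; 0 < s; \<And>z. norm z = r \<Longrightarrow> s * norm (f z) \<le> B;
       2 * pi * (\<eta> / 2) \<le> integral {0..2*pi} (\<lambda>\<theta>. s * norm (f (of_real r * cis \<theta>)))\<rbrakk> \<Longrightarrow> d \<le> s * Mp p r f"
    using Mp_ge[OF assms(1) half_gt_zero[OF \<eta>] \<open>0 < B\<close>] by blast
  have lower: "ereal d \<le> Hnorm p \<alpha> (\<lambda>z. gap_sum (\<phi> (t k) z) - gap_sum z)" for k
  proof -
    define r where "r = 1 - 1 / real (n k)"
    define s where "s = (1 - r) powr \<alpha>"
    define h where "h z = gap_sum (\<phi> (t k) z) - gap_sum z" for z
    define q where "q z = norm (\<phi> (t k) z ^ N k - z ^ N k)" for z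
    have r: "0 \<le> r" "r < 1"
      using n2[of k] by (auto simp: r_def)
    have s: "0 < s" "s * real (n k) powr \<alpha> = 1"
      using n2[of k] by (auto simp: s_def r_def powr_divide)
    have tk: "0 \<le> t k"
      using t(1)[of k] by simp
    have cont\<phi>: "continuous_on unit_disc (\<phi> (t k))"
      using hol[OF tk] by (rule holomorphic_on_imp_continuous_on)
    have conth: "continuous_on unit_disc h"
      unfolding h_def using into[OF tk]
      by (intro continuous_intros continuous_on_compose2[OF cont_sum cont\<phi>] cont_sum)
    have ratio: "1 \<le> s * real (N k) powr \<alpha>" "s * real (N k) powr \<alpha> \<le> 2 powr \<alpha>"
    proof -
      have "s * real (N k) powr \<alpha> = (real (N k) / real (n k)) powr \<alpha>"
        by (simp add: s_def r_def powr_divide)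
      moreover have "1 \<le> real (N k) / real (n k)" "real (N k) / real (n k) \<le> 2"
        using good[of k] n2[of k] by (auto simp: good_def field_simps)
      ultimately show "1 \<le> s * real (N k) powr \<alpha>" "s * real (N k) powr \<alpha> \<le> 2 powr \<alpha>"
        using assms(2) by (auto intro!: ge_one_powr_ge_zero powr_mono2)
    qed
    \<comment> \<open>After multiplication by the weight \<open>s\<close>, the error
      \<open>4 * c * real (n k) powr \<alpha>\<close> becomes \<open>4 * c\<close>, so only term
      \<open>k\<close> matters.\<close>
    have close: "\<bar>s * norm (h z) - s * real (N k) powr \<alpha> * q z\<bar> \<le> 4 * c" if "norm z = r" for z
    proof -
      have "norm (h z - (gap_term k (\<phi> (t k) z) - gap_term k z)) \<le> 4 * c * real (n k) powr \<alpha>"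
        unfolding h_def using R[OF n2, of k] that
        by (intro gap_sum_diff_approx) (auto simp: r_def)
      moreover have "norm (gap_term k (\<phi> (t k) z) - gap_term k z) = real (N k) powr \<alpha> * q z"
        by (simp add: gap_term_def q_def N_def right_diff_distrib[symmetric] norm_mult)
      ultimately have "\<bar>norm (h z) - real (N k) powr \<alpha> * q z\<bar> \<le> 4 * c * real (n k) powr \<alpha>"
        using norm_triangle_ineq3 order_trans by metis
      then have "s * \<bar>norm (h z) - real (N k) powr \<alpha> * q z\<bar> \<le> s * (4 * c * real (n k) powr \<alpha>)"
        using s by (intro mult_left_mono) auto
      also have "\<dots> = 4 * c * (s * real (n k) powr \<alpha>)"
        by (simp add: mult_ac)
      finally show ?thesis
        using s by (simp add: abs_mult_pos' right_diff_distrib mult.assoc)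
    qed
    have "d \<le> s * Mp p r h"
    proof (rule d(2)[OF conth r s(1)])
      fix z :: complex assume z: "norm z = r"
      have "norm (\<phi> (t k) z) \<le> 1"
        using into[OF tk] z r by (force simp: image_subset_iff)
      then have "q z \<le> 1 + 1"
        unfolding q_def using z r
        by (intro order_trans[OF norm_triangle_ineq4] add_mono) (auto simp: norm_power power_le_one)
      then have "s * real (N k) powr \<alpha> * q z \<le> 2 powr \<alpha> * 2"
        using ratio by (intro mult_mono) (auto simp: q_def)
      then show "s * norm (h z) \<le> B"
        using close[OF z] by (simp add: B_def)
    next
      have intq: "(\<lambda>\<theta>. q (of_real r * cis \<theta>)) integrable_on {0..2*pi}"
        unfolding q_def using r
        by (intro integrable_continuous_real continuous_intros continuous_on_circle[OF cont\<phi>])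
      have inth: "(\<lambda>\<theta>. s * norm (h (of_real r * cis \<theta>))) integrable_on {0..2*pi}"
        using r by (intro integrable_continuous_real continuous_intros continuous_on_circle[OF conth])
      have "2 * pi * \<eta> \<le> integral {0..2*pi} (\<lambda>\<theta>. q (of_real r * cis \<theta>))"
        using good[of k] by (simp add: good_def q_def r_def)
      also have "\<dots> \<le> integral {0..2*pi} (\<lambda>\<theta>. s * norm (h (of_real r * cis \<theta>)) + 4 * c)"
      proof (rule integral_le[OF intq])
        show "(\<lambda>\<theta>. s * norm (h (of_real r * cis \<theta>)) + 4 * c) integrable_on {0..2*pi}"
          by (intro integrable_add inth integrable_const_ivl)
        fix \<theta> :: real
        have "norm (of_real r * cis \<theta>) = r"
          using r by (simp add: norm_mult)
        from close[OF this]
        have "s * real (N k) powr \<alpha> * q (of_real r * cis \<theta>) \<le> s * norm (h (of_real r * cis \<theta>)) + 4 * c"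
          by linarith
        moreover have "1 * q (of_real r * cis \<theta>) \<le> s * real (N k) powr \<alpha> * q (of_real r * cis \<theta>)"
          using ratio(1) by (intro mult_right_mono) (auto simp: q_def)
        ultimately show "q (of_real r * cis \<theta>) \<le> s * norm (h (of_real r * cis \<theta>)) + 4 * c"
          by simp
      qed
      also have "\<dots> = integral {0..2*pi} (\<lambda>\<theta>. s * norm (h (of_real r * cis \<theta>))) + 2 * pi * (4 * c)"
        by (subst integral_add[OF inth integrable_const_ivl]) simp
      finally show "2 * pi * (\<eta> / 2) \<le> integral {0..2*pi} (\<lambda>\<theta>. s * norm (h (of_real r * cis \<theta>)))"
        by (simp add: c_def)
    qed
    then have "ereal d \<le> ereal ((1 - r) powr \<alpha> * Mp p r h)"
      by (simp add: s_def)
    also have "\<dots> \<le> Hnorm p \<alpha> h"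
      unfolding Hnorm_def using r by (intro SUP_upper) auto
    finally show ?thesis
      by (simp add: h_def[abs_def])
  qed

  have "gap_sum \<notin> strong_cont_space \<phi> p \<alpha>"
  proof
    assume "gap_sum \<in> strong_cont_space \<phi> p \<alpha>"
    then have lim: "((\<lambda>t. Hnorm p \<alpha> (\<lambda>z. gap_sum (\<phi> t z) - gap_sum z)) \<longlongrightarrow> 0) (at_right 0)"
      by (simp add: strong_cont_space_def)
    \<comment> \<open>Strong continuity would send the norms along these positive times to 0,
      against the uniform lower bound \<open>d\<close>.\<close>
    have "t \<longlonglongrightarrow> 0"
      using t(1,2) less_imp_le
      by (intro tendsto_sandwich[OF _ _ tendsto_const LIMSEQ_inverse_real_of_nat])
         (auto simp: inverse_eq_divide intro!: always_eventually)
    then have "filterlim t (at_right 0) sequentially"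
      using t(1) by (auto simp: filterlim_at less_imp_neq[THEN not_sym] intro!: always_eventually)
    from filterlim_compose[OF lim this]
    have "(\<lambda>k. Hnorm p \<alpha> (\<lambda>z. gap_sum (\<phi> (t k) z) - gap_sum z)) \<longlonglongrightarrow> 0" .
    then have "\<forall>\<^sub>F k in sequentially. Hnorm p \<alpha> (\<lambda>z. gap_sum (\<phi> (t k) z) - gap_sum z) < ereal d"
      using d(1) by (intro order_tendstoD(2)) auto
    then have "\<forall>\<^sub>F k in sequentially. False"
      by eventually_elim (use lower in \<open>simp add: not_less[symmetric]\<close>)
    then show False
      by simp
  qed
  with mem show ?thesis
    by (auto simp: strong_cont_space_def)
qed

end
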